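(* Let $E$ be a finite set and $(E,\mathcal{F})$ an accessible set system with $\mathcal{F}\neq\emptyset$. Let $E_{\mathcal{F}}=\bigcup_{X\in\mathcal{F}}X$, and assume $\Gamma(X)\neq\emptyset$ for every $X\in\mathcal{F}\setminus\{E_{\mathcal{F}}\}$. Then the following are equivalent: (1) $(E,\mathcal{F})$ is an antimatroid; (2) for every monotone linkage function $\pi$, every run of the Chain Algorithm with operator $\Gamma$ returns a set $X^0\in\mathcal{F}$ with $F_\Gamma(X^0)\ge F_\Gamma(Y)$ for all $Y\in\mathcal{F}\setminus\{E_{\mathcal{F}}\}$.
   Context: A set system $(E,\mathcal{F})$, $\mathcal{F}\subseteq2^E$, is accessible if for each nonempty $X\in\mathcal{F}$ there is $x\in X$ with $X\setminus\{x\}\in\mathcal{F}$. It is an antimatroid if $\mathcal{F}\ne\emptyset$, it is accessible, and for all $X,Y\in\mathcal{F}$ with $X\not\subseteq Y$ there is $x\in X\setminus Y$ with $Y\cup\{x\}\in\mathcal{F}$. For $X\in\mathcal{F}$, $\Gamma(X)=\{x\in E\setminus X: X\cup\{x\}\in\mathcal{F}\}$. A monotone linkage function is $\pi:E\times2^E\to\mathbb{R}$ with $\pi(x,X)\ge\pi(x,Y)$ whenever $X\subseteq Y$. $F_\Gamma(X)=\min_{x\in\Gamma(X)}\pi(x,X)$ (with $\min\emptyset=+\infty$). Chain Algorithm with operator $\Gamma$: set $X^0=\emptyset$, $X=\emptyset$; while $\Gamma(X)\neq\emptyset$: if $F_\Gamma(X)>F_\Gamma(X^0)$ set $X^0=X$;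 choose any $x\in\Gamma(X)$ with $\pi(x,X)\le\pi(y,X)$ for all $y\in\Gamma(X)$; set $X=X\cup\{x\}$. Return $X^0$. *)

theory Defs
  imports "HOL-Library.Extended_Real"
begin

definition set_system :: "'a set \<Rightarrow> 'a set set \<Rightarrow> bool" where
  "set_system E \<F> \<longleftrightarrow> \<F> \<subseteq> Pow E"

definition accessible :: "'a set set \<Rightarrow> bool" where
  "accessible \<F> \<longleftrightarrow> (\<forall>X\<in>\<F>. X \<noteq> {} \<longrightarrow> (\<exists>x\<in>X. X - {x} \<in> \<F>))"

definition antimatroid :: "'a set \<Rightarrow> 'a set set \<Rightarrow> bool" where
  "antimatroid E \<F> \<longleftrightarrow>
     set_system E \<F> \<and> \<F> \<noteq> {} \<and> accessible \<F> \<and>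
     (\<forall>X\<in>\<F>. \<forall>Y\<in>\<F>. \<not> X \<subseteq> Y \<longrightarrow> (\<exists>x\<in>X - Y. Y \<union> {x} \<in> \<F>))"

definition Gam :: "'a set \<Rightarrow> 'a set set \<Rightarrow> 'a set \<Rightarrow> 'a set" where
  "Gam E \<F> X = {x \<in> E - X. X \<union> {x} \<in> \<F>}"

definition monotone_linkage :: "'a set \<Rightarrow> ('a \<Rightarrow> 'a set \<Rightarrow> real) \<Rightarrow> bool" where
  "monotone_linkage E \<pi> \<longleftrightarrow>
     (\<forall>x\<in>E. \<forall>X Y. X \<subseteq> Y \<longrightarrow> Y \<subseteq> E \<longrightarrow> \<pi> x X \<ge> \<pi> x Y)"

definition linkage_min ::
    "('a set \<Rightarrow> 'a set) \<Rightarrow> ('a \<Rightarrow> 'a set \<Rightarrow> real) \<Rightarrow> 'a set \<Rightarrow> ereal" where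
  "linkage_min G \<pi> X =
     (if G X = {} then \<infinity> else ereal (Min ((\<lambda>x. \<pi> x X) ` G X)))"

text \<open>States of the Chain Algorithm are pairs \<open>(X0, X)\<close> of the current best set and the current
  set. One step is one execution of the loop body; the choice of \<open>x\<close> is nondeterministic.\<close>

inductive chain_step ::
    "('a set \<Rightarrow> 'a set) \<Rightarrow> ('a \<Rightarrow> 'a set \<Rightarrow> real) \<Rightarrow>
     'a set \<times> 'a set \<Rightarrow> 'a set \<times> 'a set \<Rightarrow> bool"
  for G \<pi> where
  "\<lbrakk>G X \<noteq> {};
    X0' = (if linkage_min G \<pi> X > linkage_min G \<pi> X0 then X else X0);
    x \<in> G X; \<forall>y\<in>G X. \<pi> x X \<le> \<pi> y X\<rbrakk>
   \<Longrightarrow> chain_step G \<pi> (X0, X) (X0', X \<union> {x})"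

text \<open>Every run terminates, and each set that can be returned satisfies \<open>P\<close>.\<close>

definition every_chain_run_returns ::
    "('a set \<Rightarrow> 'a set) \<Rightarrow> ('a \<Rightarrow> 'a set \<Rightarrow> real) \<Rightarrow> ('a set \<Rightarrow> bool) \<Rightarrow> bool" where
  "every_chain_run_returns G \<pi> P \<longleftrightarrow>
     \<not> (\<exists>s. s 0 = ({}, {}) \<and> (\<forall>n::nat. chain_step G \<pi> (s n) (s (Suc n)))) \<and>
     (\<forall>X0 X. (chain_step G \<pi>)\<^sup>*\<^sup>* ({}, {}) (X0, X) \<and> G X = {} \<longrightarrow> P X0)"

end

theory Submission
  imports Defs
begin

text \<open>
  If the system is an antimatroid, let \<open>Y \<noteq> \<Union>\<F>\<close> be feasible and let \<open>x\<close> be the first element that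
  a run adds outside \<open>Y\<close>, say to the set \<open>X \<subseteq> Y\<close>. The exchange axiom for \<open>X \<union> {x}\<close> and \<open>Y\<close> forces
  \<open>x \<in> \<Gamma>(Y)\<close>, so monotonicity gives \<open>F(Y) \<le> \<pi>(x, Y) \<le> \<pi>(x, X) = F(X)\<close>, and the run has compared
  \<open>X\<close> with its current best set.

  If exchange fails, accessibility yields feasible \<open>A \<union> {a}\<close> and \<open>Y\<close> with \<open>A \<subseteq> Y\<close>, \<open>a \<notin> Y\<close> and
  \<open>a \<notin> \<Gamma>(Y)\<close>. Let \<open>\<pi>(x, Z) = 1\<close> if \<open>x \<notin> A \<union> {a}\<close> and \<open>Z \<subseteq> Y\<close>, and \<open>\<pi>(x, Z) = 0\<close> otherwise. Some
  run builds up \<open>A \<union> {a}\<close> at cost \<open>0\<close>, and from then on all values are \<open>0\<close>; so it returns \<open>{}\<close> with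
  \<open>F({}) = 0\<close>, whereas \<open>F(Y) = 1\<close>.
\<close>

section \<open>Bounds on the linkage minimum\<close>

lemma Gam_subset: "Gam E \<F> X \<subseteq> E - X"
  by (auto simp: Gam_def)

lemma linkage_min_eq:
  assumes "finite (G X)" "x \<in> G X" "\<forall>y\<in>G X. \<pi> x X \<le> \<pi> y X"
  shows "linkage_min G \<pi> X = ereal (\<pi> x X)"
proof -
  have "Min ((\<lambda>x. \<pi> x X) ` G X) = \<pi> x X"
    using assms by (intro Min_eqI) auto
  then show ?thesis
    using assms(2) by (auto simp: linkage_min_def)
qed

lemma linkage_min_le:
  assumes "finite (G X)" "x \<in> G X"
  shows "linkage_min G \<pi> X \<le> ereal (\<pi> x X)"
  using assms by (auto simp: linkage_min_def)

text \<open>An empty \<open>G X\<close> gives the value \<infinity>, so the bound covers that case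
  too.\<close>

lemma linkage_min_ge:
  assumes "finite (G X)" "\<And>x. x \<in> G X \<Longrightarrow> c \<le> \<pi> x X"
  shows "ereal c \<le> linkage_min G \<pi> X"
  using assms by (auto simp: linkage_min_def)

section \<open>Termination and completion of runs\<close>

text \<open>Each step adds a new element of \<open>E\<close>, so after \<open>n\<close> steps the
  current set has exactly \<open>n\<close> elements, which is impossible for
  \<open>n > card E\<close>.\<close>

lemma no_infinite_chain_run:
  assumes "finite E" and sub: "\<And>X. G X \<subseteq> E - X"
  shows "\<not> (\<exists>s. s 0 = ({}, {}) \<and> (\<forall>n::nat. chain_step G \<pi> (s n) (s (Suc n))))"
proof
  assume "\<exists>s. s 0 = ({}, {}) \<and> (\<forall>n::nat. chain_step G \<pi> (s n) (s (Suc n)))"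
  then obtain s where s0: "s 0 = ({}, {})" and st: "\<And>n::nat. chain_step G \<pi> (s n) (s (Suc n))"
    by blast
  have grow: "snd (s n) \<subseteq> E \<and> card (snd (s n)) = n" for n
  proof (induction n)
    case 0
    then show ?case by (simp add: s0)
  next
    case (Suc n)
    from st[of n] obtain x where "x \<in> G (snd (s n))" "snd (s (Suc n)) = snd (s n) \<union> {x}"
      by (cases rule: chain_step.cases) auto
    then show ?case
      using Suc sub[of "snd (s n)"] \<open>finite E\<close> by (auto simp: card_insert_if finite_subset)
  qed
  then have "card (snd (s (Suc (card E)))) \<le> card E"
    using \<open>finite E\<close> card_mono by blast
  then show False
    using grow[of "Suc (card E)"] by simp
qed

text \<open>The start state is arbitrary so that a partial run built by hand can be continued to a
  completed one, the only kind about which optimality says anything.\<close>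

lemma chain_run_completes:
  assumes "finite E" and sub: "\<And>X. G X \<subseteq> E - X"
  shows "\<exists>X0' X'. (chain_step G \<pi>)\<^sup>*\<^sup>* (X0, X) (X0', X') \<and> G X' = {}"
proof (induction "card (E - X)" arbitrary: X0 X rule: less_induct)
  case less
  show ?case
  proof (cases "G X = {}")
    case True
    then show ?thesis by blast
  next
    case False
    have "finite (G X)"
      using \<open>finite E\<close> sub[of X] finite_subset by blast
    then obtain x where x: "x \<in> G X" "\<forall>y\<in>G X. \<pi> x X \<le> \<pi> y X"
      using False ex_min_if_finite[of "(\<lambda>x. \<pi> x X) ` G X"] by (force simp: not_less)
    then have step: "chain_step G \<pi> (X0, X)
        (if linkage_min G \<pi> X > linkage_min G \<pi> X0 then X else X0, X \<union> {x})"
      by (intro chain_step.intros) (use False in auto)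
    have "card (E - (X \<union> {x})) < card (E - X)"
      using x sub[of X] \<open>finite E\<close> by (intro psubset_card_mono) auto
    from less[OF this] step show ?thesis
      by (meson converse_rtranclp_into_rtranclp)
  qed
qed

section \<open>Accessible set systems\<close>

lemma accessible_empty:
  assumes "accessible \<F>" "X \<in> \<F>" "finite X"
  shows "{} \<in> \<F>"
  using assms(3,2)
proof (induction X rule: finite_psubset_induct)
  case (psubset X)
  show ?case
  proof (cases "X = {}")
    case False
    then obtain x where "x \<in> X" "X - {x} \<in> \<F>"
      using assms(1) psubset.prems by (auto simp: accessible_def)
    then show ?thesis
      using psubset.IH[of "X - {x}"] by blast
  qed (use psubset in simp)
qed

lemma accessible_singleton:
  assumes "accessible \<F>" "X \<in> \<F>" "finite X" "X \<noteq> {}"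
  shows "\<exists>x\<in>X. {x} \<in> \<F>"
  using assms(3,2,4)
proof (induction X rule: finite_psubset_induct)
  case (psubset X)
  then obtain x where x: "x \<in> X" "X - {x} \<in> \<F>"
    using assms(1) unfolding accessible_def by blast
  show ?case
  proof (cases "X = {x}")
    case False
    then have "X - {x} \<noteq> {}" "X - {x} \<subset> X"
      using x by auto
    then show ?thesis
      using psubset.IH x by blast
  qed (use psubset in auto)
qed

text \<open>Elements are peeled off \<open>X\<close> by accessibility until the rest first lies
  inside \<open>Y\<close>. The element removed last is then outside \<open>Y\<close>, and
  \<open>one_step\<close> applies to it.\<close>

lemma accessible_exchange:
  assumes acc: "accessible \<F>"
    and one_step: "\<And>A a. A \<in> \<F> \<Longrightarrow> A \<union> {a} \<in> \<F> \<Longrightarrow> A \<subseteq> Y \<Longrightarrow> a \<notin> Y \<Longrightarrow> Y \<union> {a} \<in> \<F>"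
    and "finite X" "X \<in> \<F>" "\<not> X \<subseteq> Y"
  shows "\<exists>x\<in>X - Y. Y \<union> {x} \<in> \<F>"
  using assms(3-5)
proof (induction X rule: finite_psubset_induct)
  case (psubset X)
  then obtain x where x: "x \<in> X" "X - {x} \<in> \<F>"
    using acc unfolding accessible_def by blast
  show ?case
  proof (cases "X - {x} \<subseteq> Y")
    case True
    then have "x \<notin> Y"
      using psubset.prems by blast
    moreover have "X - {x} \<union> {x} = X"
      using x by blast
    ultimately show ?thesis
      using one_step[of "X - {x}" x] x True psubset.prems by auto
  next
    case False
    then show ?thesis
      using psubset.IH[of "X - {x}"] x by blast
  qed
qed

section \<open>Optimality of the algorithm on antimatroids\<close>

text \<open>Restricting the bound to those \<open>Y\<close> that the current set has already left
  makes it vacuous at the start and preserved by each step.\<close>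

lemma antimatroid_chain_invariant:
  assumes "finite E" and anti: "antimatroid E \<F>" and mono: "monotone_linkage E \<pi>"
    and run: "(chain_step (Gam E \<F>) \<pi>)\<^sup>*\<^sup>* ({}, {}) s"
  shows "fst s \<in> \<F> \<and> snd s \<in> \<F> \<and>
    (\<forall>Y\<in>\<F>. \<not> snd s \<subseteq> Y \<longrightarrow> linkage_min (Gam E \<F>) \<pi> Y \<le> linkage_min (Gam E \<F>) \<pi> (fst s))"
  using run
proof (induction rule: rtranclp_induct)
  case base
  obtain X where "X \<in> \<F>" "X \<subseteq> E"
    using anti by (auto simp: antimatroid_def set_system_def)
  then have "{} \<in> \<F>"
    using accessible_empty anti finite_subset[OF _ \<open>finite E\<close>]
    unfolding antimatroid_def by blast
  then show ?case by simp
next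
  case (step s t)
  let ?F = "linkage_min (Gam E \<F>) \<pi>"
  have fin: "finite (Gam E \<F> X)" for X
    using Gam_subset \<open>finite E\<close> by (metis finite_Diff finite_subset)
  from step.hyps(2) obtain X0 X x where s: "s = (X0, X)"
    and t: "t = (if ?F X > ?F X0 then X else X0, X \<union> {x})"
    and x: "x \<in> Gam E \<F> X" "\<forall>y\<in>Gam E \<F> X. \<pi> x X \<le> \<pi> y X"
    by (cases rule: chain_step.cases) auto
  have FX: "?F X = ereal (\<pi> x X)"
    by (rule linkage_min_eq) (use fin x in auto)
  have best: "?F X \<le> ?F (fst t)" "?F X0 \<le> ?F (fst t)"
    by (auto simp: t)
  have Xx: "X \<union> {x} \<in> \<F>" "x \<in> E"
    using x(1) by (auto simp: Gam_def)
  have "?F Y \<le> ?F (fst t)" if Y: "Y \<in> \<F>" "\<not> X \<union> {x} \<subseteq> Y" for Y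
  proof (cases "X \<subseteq> Y")
    case False
    then have "?F Y \<le> ?F X0"
      using step.IH Y by (simp add: s)
    then show ?thesis
      using best(2) by order
  next
    case True
    have YE: "Y \<subseteq> E"
      using anti Y(1) unfolding antimatroid_def set_system_def by blast
    have "\<forall>A\<in>\<F>. \<forall>B\<in>\<F>. \<not> A \<subseteq> B \<longrightarrow> (\<exists>z\<in>A - B. B \<union> {z} \<in> \<F>)"
      using anti unfolding antimatroid_def by (elim conjE)
    from this[rule_format, OF Xx(1) Y] obtain z
      where "z \<in> X \<union> {x} - Y" "Y \<union> {z} \<in> \<F>" ..
    \<comment> \<open>Since \<open>X \<subseteq> Y\<close>, the element \<open>z\<close> can only be
      \<open>x\<close>.\<close>
    then have "x \<in> Gam E \<F> Y"
      using True Xx by (auto simp: Gam_def)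
    then have "?F Y \<le> ereal (\<pi> x Y)"
      by (intro linkage_min_le fin)
    also have "\<dots> \<le> ereal (\<pi> x X)"
      using mono True Xx(2) YE by (simp add: monotone_linkage_def)
    also have "\<dots> \<le> ?F (fst t)"
      using best FX by simp
    finally show ?thesis .
  qed
  moreover have "fst t \<in> \<F>"
    using step.IH by (simp add: s t)
  ultimately show ?case
    using Xx(1) by (simp add: t)
qed

section \<open>Exchange from optimality\<close>

text \<open>Accessibility gives an order in which \<open>A\<close> can be built up through feasible
  sets, and cost \<open>0\<close> makes each next element a legal choice because no cost is
  negative.\<close>

lemma zero_cost_chain_run:
  assumes "finite E" and nonneg: "\<And>x Z. 0 \<le> \<pi> x Z"
    and acc: "accessible \<F>" and ss: "set_system E \<F>"
    and "finite A" "A \<in> \<F>" and zero: "\<And>x Z. x \<in> A \<Longrightarrow> \<pi> x Z = 0"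
  shows "(chain_step (Gam E \<F>) \<pi>)\<^sup>*\<^sup>* ({}, {}) ({}, A)"
  using assms(5-7)
proof (induction A rule: finite_psubset_induct)
  case (psubset A)
  let ?F = "linkage_min (Gam E \<F>) \<pi>"
  have fin: "finite (Gam E \<F> X)" for X
    using Gam_subset \<open>finite E\<close> by (metis finite_Diff finite_subset)
  show ?case
  proof (cases "A = {}")
    case False
    then obtain x where x: "x \<in> A" "A - {x} \<in> \<F>"
      using acc psubset.prems(1) unfolding accessible_def by blast
    have A: "A - {x} \<union> {x} = A"
      using x by blast
    have xG: "x \<in> Gam E \<F> (A - {x})"
      using x A psubset.prems ss by (auto simp: Gam_def set_system_def)
    have min: "\<forall>y\<in>Gam E \<F> (A - {x}). \<pi> x (A - {x}) \<le> \<pi> y (A - {x})"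
      using x psubset.prems nonneg by simp
    have "?F (A - {x}) = ereal (\<pi> x (A - {x}))"
      by (rule linkage_min_eq) (use fin xG min in auto)
    moreover have "ereal 0 \<le> ?F {}"
      by (rule linkage_min_ge) (use fin nonneg in auto)
    \<comment> \<open>Only a strict improvement replaces the best set, so a value of
      \<open>0\<close> cannot displace \<open>{}\<close>.\<close>
    ultimately have "{} = (if ?F (A - {x}) > ?F {} then A - {x} else {})"
      using psubset.prems(2)[OF x(1)] by (simp add: leD)
    then have "chain_step (Gam E \<F>) \<pi> ({}, A - {x}) ({}, A - {x} \<union> {x})"
      using xG min by (intro chain_step.intros) blast+
    moreover have "(chain_step (Gam E \<F>) \<pi>)\<^sup>*\<^sup>* ({}, {}) ({}, A - {x})"
      by (rule psubset.IH) (use x psubset.prems(2) in blast)+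
    ultimately show ?thesis
      unfolding A by (metis rtranclp.rtrancl_into_rtrancl)
  qed simp
qed

lemma chain_optimal_imp_exchange_step:
  assumes "finite E" and ss: "set_system E \<F>" and acc: "accessible \<F>"
    and opt: "\<And>\<pi> X0 X Y. monotone_linkage E \<pi> \<Longrightarrow>
      (chain_step (Gam E \<F>) \<pi>)\<^sup>*\<^sup>* ({}, {}) (X0, X) \<Longrightarrow> Gam E \<F> X = {} \<Longrightarrow> Y \<in> \<F> - {\<Union>\<F>} \<Longrightarrow>
      linkage_min (Gam E \<F>) \<pi> Y \<le> linkage_min (Gam E \<F>) \<pi> X0"
    and Aa: "A \<union> {a} \<in> \<F>" and Y: "Y \<in> \<F>" "A \<subseteq> Y" "a \<notin> Y"
  shows "Y \<union> {a} \<in> \<F>"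
proof (rule ccontr)
  assume neg: "Y \<union> {a} \<notin> \<F>"
  \<comment> \<open>Only the condition \<open>Z \<subseteq> Y\<close> depends on \<open>Z\<close>.
    It can only be lost as \<open>Z\<close> grows, so \<pi> is monotone.\<close>
  define \<pi> :: "'a \<Rightarrow> 'a set \<Rightarrow> real" where "\<pi> x Z = (if x \<notin> A \<union> {a} \<and> Z \<subseteq> Y then 1 else 0)" for x Z
  let ?G = "Gam E \<F>"
  let ?F = "linkage_min ?G \<pi>"
  have fin: "finite (?G X)" for X
    using Gam_subset \<open>finite E\<close> by (metis finite_Diff finite_subset)
  have mono: "monotone_linkage E \<pi>"
    by (auto simp: monotone_linkage_def \<pi>_def)
  have finA: "finite (A \<union> {a})"
    using Aa ss \<open>finite E\<close> unfolding set_system_def by (meson PowD finite_subset subsetD)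
  have "(chain_step ?G \<pi>)\<^sup>*\<^sup>* ({}, {}) ({}, A \<union> {a})"
    by (rule zero_cost_chain_run[OF \<open>finite E\<close> _ acc ss finA Aa]) (auto simp: \<pi>_def)
  moreover obtain X0 X where X: "(chain_step ?G \<pi>)\<^sup>*\<^sup>* ({}, A \<union> {a}) (X0, X)" "?G X = {}"
    using chain_run_completes[where G = ?G, OF \<open>finite E\<close> Gam_subset] by blast
  ultimately have run: "(chain_step ?G \<pi>)\<^sup>*\<^sup>* ({}, {}) (X0, X)"
    by simp
  \<comment> \<open>While \<open>a\<close> is in the current set, that set is not contained in
    \<open>Y\<close>. Every cost is then \<open>0\<close> and \<open>{}\<close> stays the best
    set.\<close>
  have "fst (X0, X) = {} \<and> a \<in> snd (X0, X)"
    using X(1)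
  proof (induction rule: rtranclp_induct)
    case (step s t)
    have F0: "ereal 0 \<le> ?F {}"
      by (rule linkage_min_ge) (use fin in \<open>auto simp: \<pi>_def\<close>)
    from step.hyps(2) show ?case
    proof (cases rule: chain_step.cases)
      case (1 X X0' X0 x)
      have "?F X = ereal (\<pi> x X)"
        by (rule linkage_min_eq) (use fin 1 in auto)
      also have "\<pi> x X = 0"
        using step.IH 1 Y by (auto simp: \<pi>_def)
      finally show ?thesis
        using F0 step.IH 1 by (auto simp: not_less)
    qed
  qed simp
  then have X0: "X0 = {}" by simp
  \<comment> \<open>A feasible singleton inside \<open>A \<union> {a}\<close> is a first choice of
    cost \<open>0\<close>; it rules out the value \<infinity> at \<open>{}\<close>.\<close>
  obtain z where "z \<in> A \<union> {a}" "{z} \<in> \<F>"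
    using accessible_singleton[OF acc Aa finA] by auto
  moreover from this have "z \<in> ?G {}"
    using ss by (auto simp: Gam_def set_system_def)
  then have "?F {} \<le> ereal (\<pi> z {})"
    by (intro linkage_min_le fin)
  ultimately have "?F {} \<le> 0"
    by (auto simp: \<pi>_def zero_ereal_def)
  \<comment> \<open>Elements of \<Gamma>(Y) lie outside \<open>Y\<close>, hence outside
    \<open>A\<close>, and differ from \<open>a\<close> by \<open>neg\<close>; so all of them cost
    \<open>1\<close>.\<close>
  moreover have "ereal 1 \<le> ?F Y"
    by (rule linkage_min_ge) (use fin neg Y in \<open>auto simp: \<pi>_def Gam_def\<close>)
  moreover have "Y \<in> \<F> - {\<Union>\<F>}"
    using Y Aa by auto
  then have "?F Y \<le> ?F {}"
    using opt[OF mono run X(2)] X0 by simp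
  ultimately have "ereal 1 \<le> 0"
    by order
  then show False by simp
qed

theorem theorem3:
  fixes E :: "'a set" and \<F> :: "'a set set"
  assumes "finite E"
    and "set_system E \<F>"
    and "accessible \<F>"
    and "\<F> \<noteq> {}"
    and "\<forall>X \<in> \<F> - {\<Union>\<F>}. Gam E \<F> X \<noteq> {}"
  shows "antimatroid E \<F> \<longleftrightarrow>
    (\<forall>\<pi>. monotone_linkage E \<pi> \<longrightarrow>
      every_chain_run_returns (Gam E \<F>) \<pi>
        (\<lambda>X0. X0 \<in> \<F> \<and>
          (\<forall>Y \<in> \<F> - {\<Union>\<F>}. linkage_min (Gam E \<F>) \<pi> X0 \<ge> linkage_min (Gam E \<F>) \<pi> Y)))"
  (is "_ \<longleftrightarrow> ?opt")
proof
  assume anti: "antimatroid E \<F>"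
  show ?opt
    unfolding every_chain_run_returns_def
  proof (intro allI impI conjI ballI)
    fix \<pi>
    show "\<not> (\<exists>s. s 0 = ({}, {}) \<and> (\<forall>n. chain_step (Gam E \<F>) \<pi> (s n) (s (Suc n))))"
      using no_infinite_chain_run[OF \<open>finite E\<close> Gam_subset] .
  next
    fix \<pi> X0 X
    assume "monotone_linkage E \<pi>"
      and "(chain_step (Gam E \<F>) \<pi>)\<^sup>*\<^sup>* ({}, {}) (X0, X) \<and> Gam E \<F> X = {}"
    then show "X0 \<in> \<F>"
      using antimatroid_chain_invariant[OF \<open>finite E\<close> anti] by fastforce
  next
    fix \<pi> X0 X Y
    assume mono: "monotone_linkage E \<pi>"
      and run: "(chain_step (Gam E \<F>) \<pi>)\<^sup>*\<^sup>* ({}, {}) (X0, X) \<and> Gam E \<F> X = {}"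
      and Y: "Y \<in> \<F> - {\<Union>\<F>}"
    note inv = antimatroid_chain_invariant[OF \<open>finite E\<close> anti mono conjunct1[OF run]]
    \<comment> \<open>By the assumption on \<Gamma>, a run can stop only at \<Union>\<F>. It has
      then left every other feasible set, and the invariant applies to all of them.\<close>
    have "X = \<Union>\<F>"
      using inv run assms(5) by auto
    then have "\<not> X \<subseteq> Y"
      using Y by blast
    then show "linkage_min (Gam E \<F>) \<pi> Y \<le> linkage_min (Gam E \<F>) \<pi> X0"
      using inv Y by simp
  qed
next
  assume ?opt
  then have step: "Y \<union> {a} \<in> \<F>"
    if "A \<union> {a} \<in> \<F>" "Y \<in> \<F>" "A \<subseteq> Y" "a \<notin> Y" for A a Y
    using chain_optimal_imp_exchange_step[OF assms(1-3) _ that]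
    unfolding every_chain_run_returns_def by blast
  have "\<exists>x\<in>X - Y. Y \<union> {x} \<in> \<F>" if "X \<in> \<F>" "Y \<in> \<F>" "\<not> X \<subseteq> Y" for X Y
  proof (rule accessible_exchange[OF assms(3)])
    show "finite X"
      using that(1) assms(1,2) unfolding set_system_def by (meson PowD finite_subset subsetD)
  qed (use that step in auto)
  then show "antimatroid E \<F>"
    using assms by (auto simp: antimatroid_def)
qed

end
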